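(* Let $X$ be a compact space and let $Y$ be a dense subspace of $X$. If $Y$ is induced by a commutative $r$-skeleton on $X$, then $Y$ is a $\Sigma$-subset of $X$.
   Context: All spaces are Tychonoff (completely regular and Hausdorff). A retraction on $X$ is a continuous map $r:X\to X$ with $r\circ r=r$. A space is cosmic if it has a countable network. For a set $T$, $\Sigma\mathbb{R}^T=\{f\in\mathbb{R}^T : |f^{-1}(\mathbb{R}\setminus\{0\})|\leq\omega\}$. A set $Y\subseteq X$ is a $\Sigma$-subset of $X$ if there is an embedding $\phi:X\to\mathbb{R}^T$, for some set $T$, such that $Y=\phi^{-1}(\Sigma\mathbb{R}^T)$. $\Gamma$ denotes an up-directed $\sigma$-complete partially ordered set: any two elements have an upper bound, and every increasing sequence $s_0\leq s_1\leq\cdots$ in $\Gamma$ has a supremum in $\Gamma$. An $r$-skeleton on $X$ is a family $\{r_s:s\in\Gamma\}$ of retractions on $X$ such that: (i) $r_s(X)$ is cosmic for each $s\in\Gamma$; (ii) $r_s=r_s\circ r_t=r_t\circ r_s$ whenever $s\leq t$; (iii) if $s_0\leq s_1\leq\cdots$ in $\Gamma$ and $t=\sup_n s_n$, then $r_t(x)=\lim_{n\to\infty}r_{s_n}(x)$ for each $x\in X$; (iv) $x=\lim_{s\in\Gamma}r_s(x)$ (limit of a net) for every $x\in X$. The subspace induced by it is $\bigcup\{r_s(X):s\in\Gamma\}$. It is commutative if $r_s\circ r_t=r_t\circ r_s$ for all $s,t\in\Gamma$. *)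

theory Defs
  imports "HOL-Analysis.Analysis"
begin

definition tychonoff_space :: "'a topology \<Rightarrow> bool" where
  "tychonoff_space X \<longleftrightarrow> completely_regular_space X \<and> Hausdorff_space X"

definition network_of :: "'a topology \<Rightarrow> 'a set set \<Rightarrow> bool" where
  "network_of X N \<longleftrightarrow>
     (\<forall>A\<in>N. A \<subseteq> topspace X) \<and>
     (\<forall>U x. openin X U \<and> x \<in> U \<longrightarrow> (\<exists>A\<in>N. x \<in> A \<and> A \<subseteq> U))"

definition cosmic_space :: "'a topology \<Rightarrow> bool" where
  "cosmic_space X \<longleftrightarrow> (\<exists>N. countable N \<and> network_of X N)"

(* Maps are only relevant on the underlying set of X; their values elsewhere are arbitrary. *)
definition retraction_on :: "'a topology \<Rightarrow> ('a \<Rightarrow> 'a) \<Rightarrow> bool" where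
  "retraction_on X f \<longleftrightarrow> continuous_map X X f \<and> (\<forall>x\<in>topspace X. f (f x) = f x)"

definition Sigma_product :: "'t set \<Rightarrow> ('t \<Rightarrow> real) set" where
  "Sigma_product T = {f \<in> T \<rightarrow>\<^sub>E UNIV. countable {t \<in> T. f t \<noteq> 0}}"

(* HOL cannot quantify over index sets of arbitrary type inside a formula. Index sets of
   real-valued functions on the points of X are enough: see Sigma_subset_any_index below. *)
definition Sigma_subset :: "'a topology \<Rightarrow> 'a set \<Rightarrow> bool" where
  "Sigma_subset X Y \<longleftrightarrow>
     (\<exists>(T :: ('a \<Rightarrow> real) set) \<phi>.
        embedding_map X (powertop_real T) \<phi> \<and>
        Y = {x \<in> topspace X. \<phi> x \<in> Sigma_product T})"

definition up_directed :: "'s set \<Rightarrow> 's rel \<Rightarrow> bool" where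
  "up_directed \<Gamma> le \<longleftrightarrow> (\<forall>s\<in>\<Gamma>. \<forall>t\<in>\<Gamma>. \<exists>u\<in>\<Gamma>. (s, u) \<in> le \<and> (t, u) \<in> le)"

definition increasing_seq :: "'s set \<Rightarrow> 's rel \<Rightarrow> (nat \<Rightarrow> 's) \<Rightarrow> bool" where
  "increasing_seq \<Gamma> le \<sigma> \<longleftrightarrow> (\<forall>n. \<sigma> n \<in> \<Gamma> \<and> (\<sigma> n, \<sigma> (Suc n)) \<in> le)"

definition is_seq_sup :: "'s set \<Rightarrow> 's rel \<Rightarrow> (nat \<Rightarrow> 's) \<Rightarrow> 's \<Rightarrow> bool" where
  "is_seq_sup \<Gamma> le \<sigma> t \<longleftrightarrow>
     t \<in> \<Gamma> \<and> (\<forall>n. (\<sigma> n, t) \<in> le) \<and>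
     (\<forall>u\<in>\<Gamma>. (\<forall>n. (\<sigma> n, u) \<in> le) \<longrightarrow> (t, u) \<in> le)"

definition sigma_complete :: "'s set \<Rightarrow> 's rel \<Rightarrow> bool" where
  "sigma_complete \<Gamma> le \<longleftrightarrow>
     (\<forall>\<sigma>. increasing_seq \<Gamma> le \<sigma> \<longrightarrow> (\<exists>t. is_seq_sup \<Gamma> le \<sigma> t))"

(* The filter of tails, so that limitin X f x (net_filter \<Gamma> le) is convergence of the
   net (f s) indexed by \<Gamma>; see limitin_net_filter. *)
definition net_filter :: "'s set \<Rightarrow> 's rel \<Rightarrow> 's filter" where
  "net_filter \<Gamma> le = (INF s\<in>\<Gamma>. principal {t \<in> \<Gamma>. (s, t) \<in> le})"

definition r_skeleton :: "'a topology \<Rightarrow> 's set \<Rightarrow> 's rel \<Rightarrow> ('s \<Rightarrow> 'a \<Rightarrow> 'a) \<Rightarrow> bool" where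
  "r_skeleton X \<Gamma> le r \<longleftrightarrow>
     partial_order_on \<Gamma> le \<and> up_directed \<Gamma> le \<and> sigma_complete \<Gamma> le \<and>
     (\<forall>s\<in>\<Gamma>. retraction_on X (r s)) \<and>
     (\<forall>s\<in>\<Gamma>. cosmic_space (subtopology X (r s ` topspace X))) \<and>
     (\<forall>s\<in>\<Gamma>. \<forall>t\<in>\<Gamma>. (s, t) \<in> le \<longrightarrow>
        (\<forall>x\<in>topspace X. r s x = r s (r t x) \<and> r s x = r t (r s x))) \<and>
     (\<forall>\<sigma> t. increasing_seq \<Gamma> le \<sigma> \<and> is_seq_sup \<Gamma> le \<sigma> t \<longrightarrow>
        (\<forall>x\<in>topspace X. limitin X (\<lambda>n. r (\<sigma> n) x) (r t x) sequentially)) \<and>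
     (\<forall>x\<in>topspace X. limitin X (\<lambda>s. r s x) x (net_filter \<Gamma> le))"

definition commutative_family :: "'a topology \<Rightarrow> 's set \<Rightarrow> ('s \<Rightarrow> 'a \<Rightarrow> 'a) \<Rightarrow> bool" where
  "commutative_family X \<Gamma> r \<longleftrightarrow>
     (\<forall>s\<in>\<Gamma>. \<forall>t\<in>\<Gamma>. \<forall>x\<in>topspace X. r s (r t x) = r t (r s x))"

definition induced_subspace :: "'a topology \<Rightarrow> 's set \<Rightarrow> ('s \<Rightarrow> 'a \<Rightarrow> 'a) \<Rightarrow> 'a set" where
  "induced_subspace X \<Gamma> r = (\<Union>s\<in>\<Gamma>. r s ` topspace X)"

lemma limitin_net_filter:
  assumes "partial_order_on \<Gamma> le" "up_directed \<Gamma> le" "\<Gamma> \<noteq> {}"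
  shows "limitin X f x (net_filter \<Gamma> le) \<longleftrightarrow>
           x \<in> topspace X \<and>
           (\<forall>U. openin X U \<and> x \<in> U \<longrightarrow> (\<exists>s\<in>\<Gamma>. \<forall>t\<in>\<Gamma>. (s, t) \<in> le \<longrightarrow> f t \<in> U))"
proof -
  have tr: "trans le"
    using assms(1) by (simp add: partial_order_on_def preorder_on_def)
  have "eventually P (net_filter \<Gamma> le) \<longleftrightarrow> (\<exists>s\<in>\<Gamma>. \<forall>t\<in>\<Gamma>. (s, t) \<in> le \<longrightarrow> P t)" for P
    unfolding net_filter_def
  proof (subst eventually_INF_base)
    show "\<Gamma> \<noteq> {}" by fact
    fix a b assume "a \<in> \<Gamma>" "b \<in> \<Gamma>"
    then obtain u where "u \<in> \<Gamma>" "(a, u) \<in> le" "(b, u) \<in> le"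
      using assms(2) unfolding up_directed_def by blast
    then show "\<exists>x\<in>\<Gamma>. principal {t \<in> \<Gamma>. (x, t) \<in> le}
        \<le> inf (principal {t \<in> \<Gamma>. (a, t) \<in> le}) (principal {t \<in> \<Gamma>. (b, t) \<in> le})"
      using tr by (intro bexI[of _ u]) (auto dest: transD)
  qed (auto simp: eventually_principal)
  then show ?thesis by (simp add: limitin_def)
qed

lemma Sigma_subset_any_index:
  fixes S :: "'b set" and X :: "'a topology"
  assumes emb: "embedding_map X (powertop_real S) \<psi>"
    and Y: "Y = {x \<in> topspace X. \<psi> x \<in> Sigma_product S}"
  shows "Sigma_subset X Y"
proof -
  have cont: "continuous_map X (powertop_real S) \<psi>"
    using emb unfolding embedding_map_def
    by (meson continuous_map_into_fulltopology homeomorphic_imp_continuous_map)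
  define c where "c s = (\<lambda>x. \<psi> x s)" for s
  define D where "D = {f \<in> c ` S. uncountable {s \<in> S. c s = f}}"
  define T where "T = c ` S \<union> (\<lambda>(a, f). \<lambda>x. a * f x) ` (UNIV \<times> D)"
  define \<phi> where "\<phi> x = restrict (\<lambda>t. t x) T" for x
  define k where "k g = restrict (\<lambda>s. g (c s)) S" for g :: "('a \<Rightarrow> real) \<Rightarrow> real"
  have cc: "continuous_map X euclideanreal (c s)" if "s \<in> S" for s
    using cont that unfolding c_def continuous_map_componentwise by auto
  have ct: "continuous_map X euclideanreal t" if "t \<in> T" for t
    using that unfolding T_def D_def
    by (auto intro!: cc continuous_map_real_mult)
  have c\<phi>: "continuous_map X (powertop_real T) \<phi>"
    unfolding continuous_map_componentwise \<phi>_def by (auto intro: ct)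
  have ck: "continuous_map (powertop_real T) (powertop_real S) k"
    unfolding continuous_map_componentwise k_def
    by (auto intro!: continuous_map_product_projection simp: T_def)
  have ext: "\<psi> x \<in> S \<rightarrow>\<^sub>E UNIV" if "x \<in> topspace X" for x
    using continuous_map_image_subset_topspace[OF cont] that by auto
  have k\<phi>: "k (\<phi> x) = \<psi> x" if "x \<in> topspace X" for x
  proof
    fix s show "k (\<phi> x) s = \<psi> x s"
      using ext[OF that] by (auto simp: k_def \<phi>_def T_def c_def PiE_def extensional_def)
  qed
  obtain g where g: "homeomorphic_maps X (subtopology (powertop_real S) (\<psi> ` topspace X)) \<psi> g"
    using emb unfolding embedding_map_def homeomorphic_map_maps by blast
  have ck': "continuous_map (subtopology (powertop_real T) (\<phi> ` topspace X))
          (subtopology (powertop_real S) (\<psi> ` topspace X)) k"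
    using ck k\<phi>
    by (auto simp: continuous_map_in_subtopology intro: continuous_map_from_subtopology)
  have "continuous_map (subtopology (powertop_real T) (\<phi> ` topspace X)) X (g \<circ> k)"
    using g unfolding homeomorphic_maps_def by (blast intro: continuous_map_compose[OF ck'])
  then have "homeomorphic_maps X (subtopology (powertop_real T) (\<phi> ` topspace X)) \<phi> (g \<circ> k)"
    using g c\<phi> k\<phi> unfolding homeomorphic_maps_def
    by (auto simp: continuous_map_in_subtopology)
  then have emb': "embedding_map X (powertop_real T) \<phi>"
    unfolding embedding_map_def homeomorphic_map_maps by blast
  have key: "countable {s \<in> S. c s x \<noteq> 0} \<longleftrightarrow> countable {t \<in> T. t x \<noteq> 0}" for x
  proof
    assume L: "countable {s \<in> S. c s x \<noteq> 0}"
    have D0: "f x = 0" if "f \<in> D" for f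
    proof (rule ccontr)
      assume "f x \<noteq> 0"
      then have "{s \<in> S. c s = f} \<subseteq> {s \<in> S. c s x \<noteq> 0}" by auto
      then show False using L that countable_subset unfolding D_def by blast
    qed
    have "{t \<in> T. t x \<noteq> 0} \<subseteq> c ` {s \<in> S. c s x \<noteq> 0}"
      using D0 unfolding T_def by auto
    then show "countable {t \<in> T. t x \<noteq> 0}"
      by (rule countable_subset[OF _ countable_image[OF L]])
  next
    assume R: "countable {t \<in> T. t x \<noteq> 0}"
    have D0: "f x = 0" if "f \<in> D" for f
    proof (rule ccontr)
      assume fx: "f x \<noteq> 0"
      have inj: "inj_on (\<lambda>a. \<lambda>x. a * f x) (UNIV - {0::real})"
      proof (rule inj_onI)
        fix a b :: real assume "(\<lambda>x. a * f x) = (\<lambda>x. b * f x)"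
        then have "a * f x = b * f x" by (rule fun_cong)
        then show "a = b" using fx by simp
      qed
      have "(\<lambda>a. \<lambda>x. a * f x) ` (UNIV - {0::real}) \<subseteq> {t \<in> T. t x \<noteq> 0}"
        using that fx unfolding T_def by auto
      then have "countable ((\<lambda>a. \<lambda>x. a * f x) ` (UNIV - {0::real}))"
        by (rule countable_subset[OF _ R])
      then have "countable (UNIV - {0::real})"
        using inj by (rule countable_image_inj_on)
      then show False
        using uncountable_minus_countable[OF uncountable_UNIV_real, of "{0}"] by simp
    qed
    have cnt: "countable {s \<in> S. c s = t}" if "t \<in> {t \<in> c ` S. t x \<noteq> 0}" for t
      using that D0[of t] unfolding D_def by auto
    have "countable {t \<in> c ` S. t x \<noteq> 0}"
      by (rule countable_subset[OF _ R]) (auto simp: T_def)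
    then have "countable (\<Union>t\<in>{t \<in> c ` S. t x \<noteq> 0}. {s \<in> S. c s = t})"
      using cnt by (rule countable_UN)
    moreover have "{s \<in> S. c s x \<noteq> 0} \<subseteq> (\<Union>t\<in>{t \<in> c ` S. t x \<noteq> 0}. {s \<in> S. c s = t})"
      by auto
    ultimately show "countable {s \<in> S. c s x \<noteq> 0}"
      by (rule countable_subset[rotated])
  qed
  have "Y = {x \<in> topspace X. \<phi> x \<in> Sigma_product T}"
  proof -
    have "\<psi> x \<in> Sigma_product S \<longleftrightarrow> \<phi> x \<in> Sigma_product T" if "x \<in> topspace X" for x
    proof -
      have "{t \<in> T. \<phi> x t \<noteq> 0} = {t \<in> T. t x \<noteq> 0}" by (auto simp: \<phi>_def)
      then show ?thesis
        using key[of x] ext[OF that] by (simp add: Sigma_product_def c_def \<phi>_def)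
    qed
    then show ?thesis unfolding Y by auto
  qed
  with emb' show ?thesis unfolding Sigma_subset_def by blast
qed

end

theory Submission
  imports Defs
begin

text \<open>
  A compact space is embedded into a power of the reals by any set \<open>T\<close> of continuous functions
  that separates its points. So it suffices to find such a \<open>T\<close> for which the points \<open>x\<close> with
  only countably many \<open>f \<in> T\<close> not vanishing at \<open>x\<close> are exactly the points of the induced
  subspace \<open>Y\<close>.

  Fix upper bounds \<open>bound F\<close> of the finite sets of indices, monotone in \<open>F\<close>. Along an increasing
  sequence of indices the functions \<open>f \<circ> r (\<sigma> n)\<close> converge not only pointwise but uniformly
  (\<open>uniform_convergence_along_sequence\<close>), and therefore \<open>f \<circ> r (bound F)\<close> is uniformly Cauchy as
  \<open>F\<close> runs through the finite subsets of any set \<open>B\<close> of indices (\<open>uniform_Cauchy\<close>). This gives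
  a limit map \<open>rlim B\<close> for every \<open>B \<subseteq> \<Gamma>\<close>, with \<open>f \<circ> rlim B\<close> continuous; since the \<open>r s\<close>
  commute, \<open>rlim B\<close> maps \<open>Y\<close> into itself.

  A family that is point-countable on \<open>Y\<close> and separates points up to what the \<open>r (bound F)\<close> with
  \<open>F \<subseteq> B\<close> can see is called resolving for \<open>B\<close> below. It is built by induction on the cardinality
  of \<open>B\<close>. A finite \<open>B\<close> only involves one retract, which is cosmic and so has countably many
  functions separating its points. An infinite \<open>B\<close> is well-ordered in the type of its cardinal, so
  that the set of elements up to any \<open>b\<close> has smaller cardinality and has a resolving family
  \<open>S b\<close>. The differences of \<open>f\<close> after the two limit maps given by the elements up to \<open>b\<close> and by
  those strictly below \<open>b\<close>, for \<open>f \<in> S b\<close>, together resolve \<open>B\<close>: transfinite induction recovers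
  all limit maps from the differences, and a point of \<open>Y\<close> meets only countably many jumps
  (\<open>countable_jumps\<close>), because every single continuous function has only finitely many jumps of a
  given size (\<open>finite_jumps\<close>).

  For \<open>B = \<Gamma>\<close> the family separates all points since \<open>r s x\<close> converges to \<open>x\<close>. A point with
  countable support lies in \<open>Y\<close> because every continuous function \<open>f\<close> equals \<open>f \<circ> r t\<close> for
  some \<open>t\<close>: a closing-off argument then yields an index \<open>t\<close> with \<open>f (r t x) = f x\<close> for all \<open>f \<in> T\<close>, so that
  \<open>r t x = x\<close>.
\<close>

section \<open>Separation by continuous functions\<close>

lemma tychonoff_space_separate_points:
  assumes "tychonoff_space X" "x \<in> topspace X" "y \<in> topspace X" "x \<noteq> y"
  obtains f where "continuous_map X euclideanreal f" "f x = 0" "f y = 1"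
proof -
  obtain U where "openin X U" "x \<in> U" "y \<notin> U"
    using assms unfolding tychonoff_space_def Hausdorff_space_def by (metis disjnt_iff)
  then obtain f where "continuous_map X euclideanreal f" "f x = 0"
      "f ` (topspace X - U) \<subseteq> {1}"
    using assms(1) unfolding tychonoff_space_def completely_regular_space_alt' by metis
  with \<open>y \<notin> U\<close> assms(3) show thesis
    by (intro that[of f]) auto
qed

text \<open>A cluster point exists by compactness; the Cauchy condition on all real functions
  then forces the whole net to converge to it, since these functions determine the topology.\<close>

lemma compact_Cauchy_net_converges:
  assumes tych: "tychonoff_space X" and comp: "compact_space X" and nt: "F \<noteq> bot"
    and h: "eventually (\<lambda>i. h i \<in> topspace X) F"
    and cauchy: "\<And>f \<epsilon>. continuous_map X euclideanreal f \<Longrightarrow> 0 < \<epsilon> \<Longrightarrow>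
                   \<exists>c. eventually (\<lambda>i. \<bar>f (h i) - c\<bar> \<le> \<epsilon>) F"
  shows "\<exists>z. limitin X h z F"
proof -
  \<comment> \<open>A point common to all closed sets that eventually contain the net is a cluster point.\<close>
  define \<U> where "\<U> = {C. closedin X C \<and> eventually (\<lambda>i. h i \<in> C) F}"
  have "\<Inter>\<F> \<noteq> {}" if "finite \<F>" "\<F> \<subseteq> \<U>" for \<F>
  proof -
    have "eventually (\<lambda>i. \<forall>C\<in>\<F>. h i \<in> C) F"
      using that by (auto simp: \<U>_def eventually_ball_finite_distrib)
    then obtain i where "\<forall>C\<in>\<F>. h i \<in> C"
      using nt eventually_happens' by blast
    then show ?thesis by blast
  qed
  then have "\<Inter>\<U> \<noteq> {}"
    using comp unfolding compact_space_fip by (auto simp: \<U>_def)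
  then obtain z where z: "\<And>C. C \<in> \<U> \<Longrightarrow> z \<in> C" by blast
  have zX: "z \<in> topspace X"
    by (rule z) (simp add: \<U>_def h)
  have "eventually (\<lambda>i. h i \<in> U) F" if U: "openin X U" "z \<in> U" for U
  proof -
    obtain f where f: "continuous_map X euclideanreal f" "f z = 0" "f ` (topspace X - U) \<subseteq> {1}"
      using tych U unfolding tychonoff_space_def completely_regular_space_alt' by metis
    obtain c where c: "eventually (\<lambda>i. \<bar>f (h i) - c\<bar> \<le> 1/3) F"
      using cauchy[OF f(1), of "1/3"] by auto
    let ?C = "{w \<in> topspace X. f w \<in> cball c (1/3)}"
    have "closedin X ?C"
      by (rule closedin_continuous_map_preimage[OF f(1)]) simp
    moreover have "eventually (\<lambda>i. h i \<in> ?C) F"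
      using c h by eventually_elim (simp add: dist_real_def abs_minus_commute)
    ultimately have "z \<in> ?C" by (intro z) (simp add: \<U>_def)
    then have zc: "\<bar>c\<bar> \<le> 1/3" using f(2) by (simp add: dist_real_def)
    show ?thesis
      using c h
    proof eventually_elim
      case (elim i)
      show ?case
      proof (rule ccontr)
        assume "h i \<notin> U"
        then have "f (h i) = 1" using f(3) elim by auto
        then show False using elim zc by linarith
      qed
    qed
  qed
  then show ?thesis using zX by (auto simp: limitin_def)
qed

text \<open>One function for every pair of network elements that some function separates.\<close>

lemma cosmic_subspace_countably_separated:
  assumes tych: "tychonoff_space X" and M: "M \<subseteq> topspace X"
    and cosmic: "cosmic_space (subtopology X M)"
  shows "\<exists>G. countable G \<and> (\<forall>g\<in>G. continuous_map X euclideanreal g) \<and>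
             (\<forall>x\<in>M. \<forall>y\<in>M. (\<forall>g\<in>G. g x = g y) \<longrightarrow> x = y)"
proof -
  obtain N where N: "countable N" "network_of (subtopology X M) N"
    using cosmic unfolding cosmic_space_def by blast
  define P where "P = (\<lambda>(A, B) g. continuous_map X euclideanreal g \<and>
                         (\<forall>a\<in>A. g a < 1/2) \<and> (\<forall>b\<in>B. 1/2 < g b))"
  define G where "G = (\<lambda>p. SOME g. P p g) ` {p \<in> N \<times> N. \<exists>g. P p g}"
  have PG: "P p (SOME g. P p g)" if "\<exists>g. P p g" for p
    using that by (rule someI_ex)
  have "x = y" if xy: "x \<in> M" "y \<in> M" "\<forall>g\<in>G. g x = g y" for x y
  proof (rule ccontr)
    assume "x \<noteq> y"
    then obtain f where f: "continuous_map X euclideanreal f" "f x = 0" "f y = 1"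
      using tychonoff_space_separate_points[OF tych] xy(1,2) M by blast
    have op: "openin (subtopology X M) {w \<in> topspace (subtopology X M). f w \<in> S}"
      if "open S" for S
      by (rule openin_continuous_map_preimage[where Y = euclideanreal])
        (use that f(1) in \<open>auto intro: continuous_map_from_subtopology\<close>)
    have mem: "x \<in> {w \<in> topspace (subtopology X M). f w \<in> {..<1/2}}"
        "y \<in> {w \<in> topspace (subtopology X M). f w \<in> {1/2<..}}"
      using xy M f by auto
    obtain A where A: "A \<in> N" "x \<in> A" "A \<subseteq> {w \<in> topspace (subtopology X M). f w \<in> {..<1/2}}"
      using N(2) op[of "{..<1/2}"] mem unfolding network_of_def by (meson open_lessThan)
    obtain B where B: "B \<in> N" "y \<in> B" "B \<subseteq> {w \<in> topspace (subtopology X M). f w \<in> {1/2<..}}"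
      using N(2) op[of "{1/2<..}"] mem unfolding network_of_def by (meson open_greaterThan)
    have ex: "\<exists>g. P (A, B) g"
      using A B f(1) by (auto simp: P_def intro!: exI[of _ f])
    define g where "g = (SOME g. P (A, B) g)"
    have "g \<in> G" using A B ex unfolding G_def g_def by blast
    moreover have "P (A, B) g" unfolding g_def using ex by (rule PG)
    ultimately show False using A B xy(3) unfolding P_def by fastforce
  qed
  moreover have "countable G"
    unfolding G_def by (rule countable_image[OF countable_subset[OF Collect_restrict]])
      (use N(1) in auto)
  moreover have "continuous_map X euclideanreal g" if "g \<in> G" for g
  proof -
    obtain p where "\<exists>g. P p g" "g = (SOME g. P p g)" using \<open>g \<in> G\<close> unfolding G_def by blast
    then show ?thesis using PG[of p] by (auto simp: P_def split: prod.splits)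
  qed
  ultimately show ?thesis by blast
qed

lemma Sigma_subset_of_separating_family:
  assumes comp: "compact_space X"
    and cont: "\<And>f. f \<in> T \<Longrightarrow> continuous_map X euclideanreal f"
    and sep: "\<And>x y. x \<in> topspace X \<Longrightarrow> y \<in> topspace X \<Longrightarrow> \<forall>f\<in>T. f x = f y \<Longrightarrow> x = y"
  shows "Sigma_subset X {x \<in> topspace X. countable {f \<in> T. f x \<noteq> 0}}"
proof -
  define \<phi> where "\<phi> x = restrict (\<lambda>f. f x) T" for x
  have c: "continuous_map X (powertop_real T) \<phi>"
    unfolding continuous_map_componentwise \<phi>_def using cont by auto
  have "inj_on \<phi> (topspace X)"
  proof (rule inj_onI)
    fix x y assume xy: "x \<in> topspace X" "y \<in> topspace X" "\<phi> x = \<phi> y"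
    have "f x = f y" if "f \<in> T" for f
      using fun_cong[OF xy(3), of f] that by (simp add: \<phi>_def)
    then show "x = y" using sep xy by blast
  qed
  moreover have "closed_map X (powertop_real T) \<phi>"
    by (rule continuous_imp_closed_map[OF c comp]) (simp add: Hausdorff_space_product_topology)
  ultimately have "embedding_map X (powertop_real T) \<phi>"
    by (intro injective_closed_imp_embedding_map c)
  moreover have "\<phi> x \<in> Sigma_product T \<longleftrightarrow> countable {f \<in> T. f x \<noteq> 0}" for x
  proof -
    have "{t \<in> T. \<phi> x t \<noteq> 0} = {f \<in> T. f x \<noteq> 0}" by (auto simp: \<phi>_def)
    then show ?thesis by (auto simp: Sigma_product_def \<phi>_def)
  qed
  ultimately show ?thesis unfolding Sigma_subset_def by blast
qed

section \<open>Upper bounds of finite sets of indices\<close>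

text \<open>The bounds are chosen by recursion along proper inclusion, so that each one also
  bounds the bounds already chosen.\<close>

lemma monotone_finite_bounds_exist:
  assumes "up_directed \<Gamma> le" "trans le" "\<Gamma> \<noteq> {}"
  shows "\<exists>e. \<forall>F. finite F \<longrightarrow> F \<subseteq> \<Gamma> \<longrightarrow>
           e F \<in> \<Gamma> \<and> (\<forall>s\<in>F. (s, e F) \<in> le) \<and> (\<forall>G. G \<subset> F \<longrightarrow> (e G, e F) \<in> le)"
proof -
  have bound: "\<exists>u\<in>\<Gamma>. \<forall>s\<in>S. (s, u) \<in> le" if "finite S" "S \<subseteq> \<Gamma>" for S
    using that
  proof induction
    case empty
    then show ?case using assms(3) by blast
  next
    case (insert s S)
    then obtain u where "u \<in> \<Gamma>" "\<forall>s\<in>S. (s, u) \<in> le" by auto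
    moreover then obtain v where "v \<in> \<Gamma>" "(s, v) \<in> le" "(u, v) \<in> le"
      using assms(1) insert.prems unfolding up_directed_def by blast
    ultimately show ?case using assms(2) by (metis insert_iff transD)
  qed
  show ?thesis
  proof (rule dependent_wf_choice[OF wf_finite_psubset])
    fix F :: "'a set" and e e' :: "'a set \<Rightarrow> 'a" and u
    assume "\<And>z. (z, F) \<in> finite_psubset \<Longrightarrow> e z = e' z"
    then have "finite F \<Longrightarrow> G \<subset> F \<Longrightarrow> e G = e' G" for G
      by (simp add: finite_psubset_def)
    then show "(finite F \<longrightarrow> F \<subseteq> \<Gamma> \<longrightarrow>
         u \<in> \<Gamma> \<and> (\<forall>s\<in>F. (s, u) \<in> le) \<and> (\<forall>G. G \<subset> F \<longrightarrow> (e G, u) \<in> le)) =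
       (finite F \<longrightarrow> F \<subseteq> \<Gamma> \<longrightarrow>
         u \<in> \<Gamma> \<and> (\<forall>s\<in>F. (s, u) \<in> le) \<and> (\<forall>G. G \<subset> F \<longrightarrow> (e' G, u) \<in> le))"
      by auto
  next
    fix F :: "'a set" and e
    assume IH: "\<And>z. (z, F) \<in> finite_psubset \<Longrightarrow> finite z \<longrightarrow> z \<subseteq> \<Gamma> \<longrightarrow>
       e z \<in> \<Gamma> \<and> (\<forall>s\<in>z. (s, e z) \<in> le) \<and> (\<forall>G. G \<subset> z \<longrightarrow> (e G, e z) \<in> le)"
    show "\<exists>u. finite F \<longrightarrow> F \<subseteq> \<Gamma> \<longrightarrow>
         u \<in> \<Gamma> \<and> (\<forall>s\<in>F. (s, u) \<in> le) \<and> (\<forall>G. G \<subset> F \<longrightarrow> (e G, u) \<in> le)"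
    proof (cases "finite F \<and> F \<subseteq> \<Gamma>")
      case True
      then have fin: "finite {G. G \<subset> F}"
        by (auto intro: finite_subset[of _ "Pow F"])
      have "e G \<in> \<Gamma>" if "G \<subset> F" for G
      proof -
        have "finite G" using True that by (meson finite_subset psubset_imp_subset)
        then show ?thesis using IH[of G] True that by (auto simp: finite_psubset_def)
      qed
      then have "\<exists>u\<in>\<Gamma>. \<forall>s\<in>F \<union> e ` {G. G \<subset> F}. (s, u) \<in> le"
        using True fin by (intro bound) auto
      then show ?thesis by blast
    qed auto
  qed
qed

section \<open>Retractions attached to arbitrary sets of indices\<close>

locale compact_r_skeleton =
  fixes X :: "'a topology" and \<Gamma> :: "'s set" and le :: "'s rel" and r :: "'s \<Rightarrow> 'a \<Rightarrow> 'a"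
  assumes tych: "tychonoff_space X" and comp: "compact_space X"
    and skel: "r_skeleton X \<Gamma> le r" and index_nonempty: "\<Gamma> \<noteq> {}"
begin

abbreviation cont_fun :: "('a \<Rightarrow> real) \<Rightarrow> bool" where
  "cont_fun f \<equiv> continuous_map X euclideanreal f"

lemma hausdorff: "Hausdorff_space X"
  using tych by (simp add: tychonoff_space_def)

lemma directed: "up_directed \<Gamma> le"
  using skel by (simp add: r_skeleton_def)

lemma trans_le: "trans le"
  using skel by (simp add: r_skeleton_def partial_order_on_def preorder_on_def)

lemma refl_le: "s \<in> \<Gamma> \<Longrightarrow> (s, s) \<in> le"
  using skel by (simp add: r_skeleton_def partial_order_on_def preorder_on_def refl_on_def)

lemma continuous_r: "s \<in> \<Gamma> \<Longrightarrow> continuous_map X X (r s)"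
  using skel by (simp add: r_skeleton_def retraction_on_def)

lemma r_in [simp]: "s \<in> \<Gamma> \<Longrightarrow> x \<in> topspace X \<Longrightarrow> r s x \<in> topspace X"
  using continuous_map_image_subset_topspace[OF continuous_r] by blast

lemma continuous_fun_r: "cont_fun f \<Longrightarrow> s \<in> \<Gamma> \<Longrightarrow> cont_fun (\<lambda>x. f (r s x))"
  using continuous_map_compose[OF continuous_r] by (simp add: o_def)

lemma r_idem [simp]: "s \<in> \<Gamma> \<Longrightarrow> x \<in> topspace X \<Longrightarrow> r s (r s x) = r s x"
  using skel by (simp add: r_skeleton_def retraction_on_def)

lemma cosmic_range: "s \<in> \<Gamma> \<Longrightarrow> cosmic_space (subtopology X (r s ` topspace X))"
  using skel by (simp add: r_skeleton_def)

lemma r_r_le: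
  assumes "s \<in> \<Gamma>" "t \<in> \<Gamma>" "(s, t) \<in> le" "x \<in> topspace X"
  shows "r s (r t x) = r s x" "r t (r s x) = r s x"
  using skel assms unfolding r_skeleton_def by metis+

lemma seq_sup_exists: "increasing_seq \<Gamma> le \<sigma> \<Longrightarrow> \<exists>t. is_seq_sup \<Gamma> le \<sigma> t"
  using skel by (simp add: r_skeleton_def sigma_complete_def)

lemma limitin_seq_sup:
  "increasing_seq \<Gamma> le \<sigma> \<Longrightarrow> is_seq_sup \<Gamma> le \<sigma> t \<Longrightarrow> x \<in> topspace X \<Longrightarrow>
    limitin X (\<lambda>n. r (\<sigma> n) x) (r t x) sequentially"
  using skel unfolding r_skeleton_def by blast

lemma eventually_in_open:
  assumes "openin X U" "x \<in> U"
  shows "\<exists>s\<in>\<Gamma>. \<forall>t\<in>\<Gamma>. (s, t) \<in> le \<longrightarrow> r t x \<in> U"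
proof -
  have "limitin X (\<lambda>s. r s x) x (net_filter \<Gamma> le)"
    using skel assms openin_subset unfolding r_skeleton_def by blast
  moreover have "partial_order_on \<Gamma> le" "up_directed \<Gamma> le"
    using skel by (simp_all add: r_skeleton_def)
  ultimately show ?thesis
    using assms by (subst (asm) limitin_net_filter) (use index_nonempty in auto)
qed

lemma eventually_close:
  assumes "cont_fun f" "x \<in> topspace X" "0 < \<epsilon>"
  shows "\<exists>s\<in>\<Gamma>. \<forall>t\<in>\<Gamma>. (s, t) \<in> le \<longrightarrow> \<bar>f (r t x) - f x\<bar> < \<epsilon>"
proof -
  have "openin X {w \<in> topspace X. f w \<in> ball (f x) \<epsilon>}"
    by (rule openin_continuous_map_preimage[OF assms(1)]) simp
  from eventually_in_open[OF this, of x] assms show ?thesis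
    by (simp add: dist_real_def abs_minus_commute)
qed

text \<open>The net \<open>r s x\<close> converges to \<open>x\<close>, and limits in a Hausdorff space are unique.\<close>

lemma r_separates:
  assumes "x \<in> topspace X" "y \<in> topspace X" "\<And>s. s \<in> \<Gamma> \<Longrightarrow> r s x = r s y"
  shows "x = y"
proof (rule ccontr)
  assume "x \<noteq> y"
  then obtain U V where UV: "openin X U" "openin X V" "x \<in> U" "y \<in> V" "disjnt U V"
    using hausdorff assms unfolding Hausdorff_space_def by metis
  obtain s t where st: "s \<in> \<Gamma>" "t \<in> \<Gamma>"
     "\<forall>u\<in>\<Gamma>. (s, u) \<in> le \<longrightarrow> r u x \<in> U" "\<forall>u\<in>\<Gamma>. (t, u) \<in> le \<longrightarrow> r u y \<in> V"
    using eventually_in_open UV by metis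
  moreover obtain u where "u \<in> \<Gamma>" "(s, u) \<in> le" "(t, u) \<in> le"
    using directed st unfolding up_directed_def by blast
  ultimately have "r u x \<in> U" "r u y \<in> V" by auto
  then show False using assms(3)[OF \<open>u \<in> \<Gamma>\<close>] UV(5) by (auto simp: disjnt_iff)
qed

lemma increasing_seq_mono:
  assumes "increasing_seq \<Gamma> le \<sigma>" "m \<le> n"
  shows "(\<sigma> m, \<sigma> n) \<in> le"
  using assms(2)
proof (induction rule: dec_induct)
  case base
  then show ?case using assms(1) refl_le by (simp add: increasing_seq_def)
next
  case (step k)
  then show ?case using assms(1) trans_le by (meson increasing_seq_def transD)
qed

text \<open>Dini-like step: a pair of points of the range of \<open>r t\<close> that all \<open>r (\<sigma> m)\<close> identify is
  trivial, so by compactness of \<open>X \<times> X\<close> some single \<open>r (\<sigma> m)\<close> already keeps apart all pairs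
  on which \<open>f\<close> differs by \<open>\<epsilon>\<close>. For \<open>n \<ge> m\<close> the points \<open>r (\<sigma> n) x\<close> and \<open>r t x\<close> are
  identified by \<open>r (\<sigma> m)\<close>.\<close>

lemma uniform_convergence_along_sequence:
  assumes \<sigma>: "increasing_seq \<Gamma> le \<sigma>" and t: "is_seq_sup \<Gamma> le \<sigma> t"
    and f: "cont_fun f" and \<epsilon>: "0 < \<epsilon>"
  shows "\<exists>m. \<forall>n\<ge>m. \<forall>x\<in>topspace X. \<bar>f (r (\<sigma> n) x) - f (r t x)\<bar> < \<epsilon>"
proof -
  let ?XX = "prod_topology X X"
  have \<sigma>\<Gamma>: "\<sigma> n \<in> \<Gamma>" for n using \<sigma> by (simp add: increasing_seq_def)
  have t\<Gamma>: "t \<in> \<Gamma>" and \<sigma>t: "(\<sigma> n, t) \<in> le" for n using t by (simp_all add: is_seq_sup_def)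
  \<comment> \<open>Pairs of points in the range of \<open>r t\<close> that \<open>r (\<sigma> m)\<close> fails to distinguish, but \<open>f\<close> does.\<close>
  define K where "K m = {p \<in> topspace ?XX. r (\<sigma> m) (fst p) = r (\<sigma> m) (snd p)} \<inter>
     {p \<in> topspace ?XX. r t (fst p) = fst p} \<inter> {p \<in> topspace ?XX. r t (snd p) = snd p} \<inter>
     {p \<in> topspace ?XX. \<bar>f (fst p) - f (snd p)\<bar> \<in> {\<epsilon>..}}" for m
  have fs: "continuous_map ?XX X fst" "continuous_map ?XX X snd"
    by (simp_all add: continuous_map_fst continuous_map_snd)
  have rfs: "continuous_map ?XX X (\<lambda>p. r s (fst p))" "continuous_map ?XX X (\<lambda>p. r s (snd p))"
    if "s \<in> \<Gamma>" for s
    using continuous_map_compose[OF fs(1) continuous_r[OF that]]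
      continuous_map_compose[OF fs(2) continuous_r[OF that]] by (simp_all add: o_def)
  have ff: "continuous_map ?XX euclideanreal (\<lambda>p. \<bar>f (fst p) - f (snd p)\<bar>)"
    using continuous_map_compose[OF fs(1) f] continuous_map_compose[OF fs(2) f]
    by (intro continuous_map_real_abs continuous_map_diff) (simp_all add: o_def)
  have closed: "closedin ?XX (K m)" for m
    unfolding K_def
    by (intro closedin_Int closedin_continuous_maps_eq[OF hausdorff] rfs fs \<sigma>\<Gamma> t\<Gamma>
        closedin_continuous_map_preimage[OF ff]) simp
  have "decseq K"
  proof (rule decseq_SucI, rule subsetI)
    fix n p assume p: "p \<in> K (Suc n)"
    have le: "(\<sigma> n, \<sigma> (Suc n)) \<in> le" using \<sigma> by (simp add: increasing_seq_def)
    have "r (\<sigma> n) (fst p) = r (\<sigma> n) (snd p)"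
      using p r_r_le(1)[OF \<sigma>\<Gamma> \<sigma>\<Gamma> le, of "fst p"] r_r_le(1)[OF \<sigma>\<Gamma> \<sigma>\<Gamma> le, of "snd p"]
      by (auto simp: K_def)
    then show "p \<in> K n" using p by (simp add: K_def)
  qed
  moreover have "(\<Inter>n. K n) = {}"
  proof (rule ccontr)
    assume "(\<Inter>n. K n) \<noteq> {}"
    then obtain a b where ab: "\<And>n. (a, b) \<in> K n" by auto
    have X: "a \<in> topspace X" "b \<in> topspace X" using ab[of 0] by (auto simp: K_def)
    have "(\<lambda>n. r (\<sigma> n) a) = (\<lambda>n. r (\<sigma> n) b)" using ab by (auto simp: K_def)
    then have "r t a = r t b"
      using limitin_seq_sup[OF \<sigma> t X(1)] limitin_seq_sup[OF \<sigma> t X(2)] hausdorff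
        limitin_Hausdorff_unique trivial_limit_sequentially by metis
    then show False using ab[of 0] \<epsilon> by (auto simp: K_def)
  qed
  ultimately obtain m where m: "K m = {}"
    using compact_space_imp_nest[of ?XX K] closed comp compact_space_prod_topology by blast
  have "\<bar>f (r (\<sigma> n) x) - f (r t x)\<bar> < \<epsilon>" if "m \<le> n" "x \<in> topspace X" for n x
  proof -
    have "(r (\<sigma> n) x, r t x) \<notin> K m" using m by simp
    moreover have "r (\<sigma> m) (r (\<sigma> n) x) = r (\<sigma> m) (r t x)"
      using r_r_le(1)[OF \<sigma>\<Gamma> \<sigma>\<Gamma> increasing_seq_mono[OF \<sigma> that(1)]] r_r_le(1)[OF \<sigma>\<Gamma> t\<Gamma> \<sigma>t] that
      by simp
    ultimately show ?thesis
      using that r_r_le(2)[OF \<sigma>\<Gamma> t\<Gamma> \<sigma>t that(2)] \<sigma>\<Gamma> t\<Gamma> by (auto simp: K_def)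
  qed
  then show ?thesis by blast
qed

definition bound :: "'s set \<Rightarrow> 's" where
  "bound = (SOME e. \<forall>F. finite F \<longrightarrow> F \<subseteq> \<Gamma> \<longrightarrow>
     e F \<in> \<Gamma> \<and> (\<forall>s\<in>F. (s, e F) \<in> le) \<and> (\<forall>G. G \<subset> F \<longrightarrow> (e G, e F) \<in> le))"

lemma bound_spec:
  "\<forall>F. finite F \<longrightarrow> F \<subseteq> \<Gamma> \<longrightarrow>
     bound F \<in> \<Gamma> \<and> (\<forall>s\<in>F. (s, bound F) \<in> le) \<and> (\<forall>G. G \<subset> F \<longrightarrow> (bound G, bound F) \<in> le)"
  unfolding bound_def
  by (rule someI_ex[OF monotone_finite_bounds_exist])
    (use skel trans_le index_nonempty in \<open>auto simp: r_skeleton_def\<close>)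

lemma bound_in [simp]: "finite F \<Longrightarrow> F \<subseteq> \<Gamma> \<Longrightarrow> bound F \<in> \<Gamma>"
  using bound_spec by blast

lemma le_bound: "finite F \<Longrightarrow> F \<subseteq> \<Gamma> \<Longrightarrow> s \<in> F \<Longrightarrow> (s, bound F) \<in> le"
  using bound_spec by blast

lemma bound_mono:
  assumes "finite F" "F \<subseteq> \<Gamma>" "G \<subseteq> F"
  shows "(bound G, bound F) \<in> le"
proof (cases "G = F")
  case True
  then show ?thesis using assms refl_le by simp
next
  case False
  then show ?thesis using assms bound_spec by blast
qed

lemma r_bound_r_bound:
  assumes "finite F" "F \<subseteq> \<Gamma>" "G \<subseteq> F" "x \<in> topspace X"
  shows "r (bound G) (r (bound F) x) = r (bound G) x"
proof -
  have "finite G" using assms by (meson finite_subset)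
  then show ?thesis using assms by (intro r_r_le bound_mono) auto
qed

lemma countable_upper_bound:
  assumes "countable C" "C \<subseteq> \<Gamma>"
  shows "\<exists>t\<in>\<Gamma>. \<forall>s\<in>C. (s, t) \<in> le"
proof (cases "C = {}")
  case True
  then show ?thesis using index_nonempty by blast
next
  case False
  then obtain c :: "nat \<Rightarrow> 's" where c: "C = range c"
    using assms(1) by (metis uncountable_def)
  define \<sigma> where "\<sigma> n = bound (c ` {..n})" for n
  have "increasing_seq \<Gamma> le \<sigma>"
    unfolding increasing_seq_def \<sigma>_def using assms(2) c
    by (intro allI conjI bound_in bound_mono) auto
  then obtain t where t: "is_seq_sup \<Gamma> le \<sigma> t" using seq_sup_exists by blast
  have "(c n, t) \<in> le" for n
  proof -
    have "(c n, \<sigma> n) \<in> le" unfolding \<sigma>_def using assms(2) c by (intro le_bound) auto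
    moreover have "(\<sigma> n, t) \<in> le" using t by (simp add: is_seq_sup_def)
    ultimately show ?thesis using trans_le by (meson transD)
  qed
  then show ?thesis using t c by (auto simp: is_seq_sup_def)
qed

text \<open>A failure would produce an increasing sequence of indices along which \<open>f \<circ> r\<close> jumps
  by more than \<open>\<epsilon>\<close> at every step, although it converges uniformly.\<close>

lemma uniform_Cauchy:
  assumes B: "B \<subseteq> \<Gamma>" and f: "cont_fun f" and \<epsilon>: "0 < \<epsilon>"
  obtains F0 where "finite F0" "F0 \<subseteq> B"
    "\<And>F x. finite F \<Longrightarrow> F0 \<subseteq> F \<Longrightarrow> F \<subseteq> B \<Longrightarrow> x \<in> topspace X \<Longrightarrow>
       \<bar>f (r (bound F) x) - f (r (bound F0) x)\<bar> \<le> \<epsilon>"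
proof (rule ccontr)
  note found = that
  assume no: "\<not> thesis"
  have step: "\<exists>F. (finite F \<and> F \<subseteq> B) \<and> F0 \<subseteq> F \<and>
      (\<exists>x\<in>topspace X. \<epsilon> < \<bar>f (r (bound F) x) - f (r (bound F0) x)\<bar>)"
    if "finite F0 \<and> F0 \<subseteq> B" for F0
    using no found[of F0] that by (metis linorder_not_le)
  obtain G where G: "\<And>n. finite (G n)" "\<And>n. G n \<subseteq> B" "\<And>n. G n \<subseteq> G (Suc n)"
    and jump: "\<And>n. \<exists>x\<in>topspace X. \<epsilon> < \<bar>f (r (bound (G (Suc n))) x) - f (r (bound (G n)) x)\<bar>"
    using dependent_nat_choice[of "\<lambda>_ F. finite F \<and> F \<subseteq> B"
        "\<lambda>_ F0 F. F0 \<subseteq> F \<and> (\<exists>x\<in>topspace X. \<epsilon> < \<bar>f (r (bound F) x) - f (r (bound F0) x)\<bar>)"]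
      step by (metis empty_subsetI finite.emptyI)
  have inc: "increasing_seq \<Gamma> le (\<lambda>n. bound (G n))"
    unfolding increasing_seq_def using G B by (meson bound_in bound_mono subset_trans)
  then obtain t where "is_seq_sup \<Gamma> le (\<lambda>n. bound (G n)) t" using seq_sup_exists by blast
  from uniform_convergence_along_sequence[OF inc this f, of "\<epsilon>/2"] \<epsilon>
  obtain m where m: "\<And>n x. m \<le> n \<Longrightarrow> x \<in> topspace X \<Longrightarrow>
      \<bar>f (r (bound (G n)) x) - f (r t x)\<bar> < \<epsilon>/2" by auto
  obtain x where "x \<in> topspace X" "\<epsilon> < \<bar>f (r (bound (G (Suc m))) x) - f (r (bound (G m)) x)\<bar>"
    using jump by blast
  then show False using m[OF order_refl, of x] m[OF le_SucI[OF order_refl], of x] by linarith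
qed

definition rlim :: "'s set \<Rightarrow> 'a \<Rightarrow> 'a" where
  "rlim B x = (SOME z. limitin X (\<lambda>F. r (bound F) x) z (finite_subsets_at_top B))"

lemma limitin_rlim:
  assumes B: "B \<subseteq> \<Gamma>" and x: "x \<in> topspace X"
  shows "limitin X (\<lambda>F. r (bound F) x) (rlim B x) (finite_subsets_at_top B)"
  unfolding rlim_def
proof (rule someI_ex, rule compact_Cauchy_net_converges[OF tych comp])
  show "eventually (\<lambda>F. r (bound F) x \<in> topspace X) (finite_subsets_at_top B)"
    using B x by (intro eventually_finite_subsets_at_top_weakI) auto
next
  fix f and \<epsilon> :: real assume "cont_fun f" "0 < \<epsilon>"
  from uniform_Cauchy[OF B this] obtain F0 where "finite F0" "F0 \<subseteq> B"
    "\<And>F x. finite F \<Longrightarrow> F0 \<subseteq> F \<Longrightarrow> F \<subseteq> B \<Longrightarrow> x \<in> topspace X \<Longrightarrow>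
       \<bar>f (r (bound F) x) - f (r (bound F0) x)\<bar> \<le> \<epsilon>" by blast
  then show "\<exists>c. eventually (\<lambda>F. \<bar>f (r (bound F) x) - c\<bar> \<le> \<epsilon>) (finite_subsets_at_top B)"
    unfolding eventually_finite_subsets_at_top using x
    by (intro exI[of _ "f (r (bound F0) x)"] exI[of _ F0]) simp
qed simp

text \<open>All pointwise properties of \<open>rlim B\<close> are obtained by passing to the limit inside a
  closed set that eventually contains the net.\<close>

lemma rlim_in_closed:
  assumes "B \<subseteq> \<Gamma>" "x \<in> topspace X" "closedin X S" "finite F0" "F0 \<subseteq> B"
    and "\<And>F. finite F \<Longrightarrow> F0 \<subseteq> F \<Longrightarrow> F \<subseteq> B \<Longrightarrow> r (bound F) x \<in> S"
  shows "rlim B x \<in> S"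
proof (rule limitin_closedin[OF limitin_rlim[OF assms(1,2)] assms(3)])
  show "eventually (\<lambda>F. r (bound F) x \<in> S) (finite_subsets_at_top B)"
    unfolding eventually_finite_subsets_at_top using assms(4-6) by blast
qed simp

lemma rlim_in [simp]: "B \<subseteq> \<Gamma> \<Longrightarrow> x \<in> topspace X \<Longrightarrow> rlim B x \<in> topspace X"
  by (rule limitin_topspace[OF limitin_rlim])

lemma r_bound_rlim:
  assumes "B \<subseteq> \<Gamma>" "finite F" "F \<subseteq> B" "x \<in> topspace X"
  shows "r (bound F) (rlim B x) = r (bound F) x"
proof -
  have F: "bound F \<in> \<Gamma>" using assms by auto
  have "rlim B x \<in> {w \<in> topspace X. r (bound F) w = r (bound F) x}"
  proof (rule rlim_in_closed[OF assms(1,4) _ assms(2,3)])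
    show "closedin X {w \<in> topspace X. r (bound F) w = r (bound F) x}"
      by (rule closedin_continuous_maps_eq[OF hausdorff continuous_r[OF F]])
        (use F assms in simp)
    fix G assume "finite G" "F \<subseteq> G" "G \<subseteq> B"
    then show "r (bound G) x \<in> {w \<in> topspace X. r (bound F) w = r (bound F) x}"
      using assms r_bound_r_bound[of G F x] by auto
  qed
  then show ?thesis by simp
qed

lemma rlim_finite:
  assumes "finite F" "F \<subseteq> \<Gamma>" "x \<in> topspace X"
  shows "rlim F x = r (bound F) x"
proof -
  have "rlim F x \<in> {r (bound F) x}"
  proof (rule rlim_in_closed[OF assms(2,3) _ assms(1) subset_refl])
    show "closedin X {r (bound F) x}"
      using assms by (intro closedin_Hausdorff_singleton hausdorff) simp
  qed auto
  then show ?thesis by simp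
qed

text \<open>One finite set controls \<open>rlim C\<close> for all \<open>C\<close> above it at once; this is what bounds the
  number of jumps along an increasing chain of sets \<open>C\<close>.\<close>

lemma rlim_uniformly_close:
  assumes B: "B \<subseteq> \<Gamma>" and f: "cont_fun f" and \<epsilon>: "0 < \<epsilon>"
  obtains F0 where "finite F0" "F0 \<subseteq> B"
    "\<And>C x. F0 \<subseteq> C \<Longrightarrow> C \<subseteq> B \<Longrightarrow> x \<in> topspace X \<Longrightarrow>
       \<bar>f (rlim C x) - f (r (bound F0) x)\<bar> \<le> \<epsilon>"
proof -
  obtain F0 where F0: "finite F0" "F0 \<subseteq> B"
    "\<And>F x. finite F \<Longrightarrow> F0 \<subseteq> F \<Longrightarrow> F \<subseteq> B \<Longrightarrow> x \<in> topspace X \<Longrightarrow>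
       \<bar>f (r (bound F) x) - f (r (bound F0) x)\<bar> \<le> \<epsilon>"
    using uniform_Cauchy[OF assms] by blast
  have "\<bar>f (rlim C x) - f (r (bound F0) x)\<bar> \<le> \<epsilon>" if C: "F0 \<subseteq> C" "C \<subseteq> B" and x: "x \<in> topspace X"
    for C x
  proof -
    let ?S = "{w \<in> topspace X. f w \<in> cball (f (r (bound F0) x)) \<epsilon>}"
    have "rlim C x \<in> ?S"
    proof (rule rlim_in_closed[OF _ x _ F0(1) C(1)])
      show "C \<subseteq> \<Gamma>" using B C by blast
      show "closedin X ?S"
        by (rule closedin_continuous_map_preimage[OF f]) simp
      fix F assume "finite F" "F0 \<subseteq> F" "F \<subseteq> C"
      then show "r (bound F) x \<in> ?S"
        using F0(3)[of F x] x B C by (auto simp: dist_real_def abs_minus_commute)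
    qed
    then show ?thesis by (simp add: dist_real_def abs_minus_commute)
  qed
  with F0(1,2) show thesis by (rule that)
qed

lemma continuous_fun_rlim:
  assumes B: "B \<subseteq> \<Gamma>" and f: "cont_fun f"
  shows "cont_fun (\<lambda>x. f (rlim B x))"
proof -
  have "continuous_map X Met_TC.mtopology (\<lambda>x. f (rlim B x))"
  proof (rule Met_TC.continuous_map_uniform_limit_alt
      [where F = "finite_subsets_at_top B" and f = "\<lambda>F x. f (r (bound F) x)"])
    show "eventually (\<lambda>F. continuous_map X Met_TC.mtopology (\<lambda>x. f (r (bound F) x)))
            (finite_subsets_at_top B)"
      using B f by (intro eventually_finite_subsets_at_top_weakI) (auto intro!: continuous_fun_r)
  next
    fix \<epsilon> :: real assume "0 < \<epsilon>"
    then have e: "0 < \<epsilon>/3" by simp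
    obtain F0 where F0: "finite F0" "F0 \<subseteq> B"
      "\<And>C x. F0 \<subseteq> C \<Longrightarrow> C \<subseteq> B \<Longrightarrow> x \<in> topspace X \<Longrightarrow>
         \<bar>f (rlim C x) - f (r (bound F0) x)\<bar> \<le> \<epsilon>/3"
      using rlim_uniformly_close[OF B f e] by blast
    have "dist (f (r (bound F) x)) (f (rlim B x)) < \<epsilon>"
      if F: "finite F" "F0 \<subseteq> F" "F \<subseteq> B" and x: "x \<in> topspace X" for F x
    proof -
      have "\<bar>f (r (bound F) x) - f (r (bound F0) x)\<bar> \<le> \<epsilon>/3"
        using F0(3)[OF F(2,3) x] rlim_finite[OF F(1) _ x] F(3) B by auto
      moreover have "\<bar>f (rlim B x) - f (r (bound F0) x)\<bar> \<le> \<epsilon>/3"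
        by (rule F0(3)[OF F0(2) subset_refl x])
      ultimately show ?thesis using \<open>0 < \<epsilon>\<close> unfolding dist_real_def by linarith
    qed
    then show "eventually (\<lambda>F. \<forall>x\<in>topspace X. dist (f (r (bound F) x)) (f (rlim B x)) < \<epsilon>)
            (finite_subsets_at_top B)"
      unfolding eventually_finite_subsets_at_top using F0(1,2) by blast
  qed auto
  then show ?thesis by simp
qed

text \<open>Induction along the well-order: an initial segment \<open>A\<close> is controlled by
  a finite subset \<open>F0\<close>: a jump at \<open>b\<close> can only happen while the elements below \<open>b\<close> do not yet
  comprise \<open>F0\<close>, so all jumps in \<open>A\<close> lie at or below one of the finitely many elements of \<open>F0\<close>.\<close>

lemma finite_jumps:
  assumes R: "Well_order R" and \<Gamma>: "Field R \<subseteq> \<Gamma>" and f: "cont_fun f" and \<epsilon>: "0 < \<epsilon>"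
    and x: "x \<in> topspace X"
  shows "finite {b \<in> Field R. \<epsilon> < \<bar>f (rlim (under R b) x) - f (rlim (underS R b) x)\<bar>}" (is "finite ?J")
proof -
  have lin: "wo_rel R" using R by (simp add: wo_rel_def)
  have segment: "finite (?J \<inter> A)"
    if A: "A \<subseteq> Field R" "\<And>d. d \<in> A \<Longrightarrow> under R d \<subseteq> A"
      and IH: "\<And>d. d \<in> A \<Longrightarrow> finite (?J \<inter> underS R d)" for A
  proof -
    obtain F0 where F0: "finite F0" "F0 \<subseteq> A"
      "\<And>C x. F0 \<subseteq> C \<Longrightarrow> C \<subseteq> A \<Longrightarrow> x \<in> topspace X \<Longrightarrow>
         \<bar>f (rlim C x) - f (r (bound F0) x)\<bar> \<le> \<epsilon>/2"
      using rlim_uniformly_close[OF subset_trans[OF A(1) \<Gamma>] f half_gt_zero[OF \<epsilon>]] by blast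
    have "b \<in> (\<Union>d\<in>F0. insert d (?J \<inter> underS R d))" if b: "b \<in> ?J \<inter> A" for b
    proof -
      have sub: "underS R b \<subseteq> under R b" "under R b \<subseteq> A"
        using A b by (auto simp: underS_def under_def)
      have "\<not> F0 \<subseteq> underS R b"
      proof
        assume "F0 \<subseteq> underS R b"
        then have "\<bar>f (rlim (under R b) x) - f (r (bound F0) x)\<bar> \<le> \<epsilon>/2"
            "\<bar>f (rlim (underS R b) x) - f (r (bound F0) x)\<bar> \<le> \<epsilon>/2"
          using F0(3)[of "under R b" x] F0(3)[of "underS R b" x] sub x by auto
        moreover have "\<epsilon> < \<bar>f (rlim (under R b) x) - f (rlim (underS R b) x)\<bar>"
          using b by simp
        ultimately show False by linarith
      qed
      then obtain d where d: "d \<in> F0" "d \<notin> underS R b" by blast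
      then have "d = b \<or> b \<in> underS R d"
        using wo_rel.TOTALS[OF lin] A(1) F0(2) b by (auto simp: underS_def)
      then show ?thesis using d b by blast
    qed
    then have "?J \<inter> A \<subseteq> (\<Union>d\<in>F0. insert d (?J \<inter> underS R d))" by blast
    moreover have "finite (\<Union>d\<in>F0. insert d (?J \<inter> underS R d))"
      using F0(1,2) IH by auto
    ultimately show ?thesis by (rule finite_subset)
  qed
  have below: "finite (?J \<inter> underS R d)" for d
  proof (induction d rule: wo_rel.well_order_induct[OF lin])
    case (1 d)
    show ?case
    proof (rule segment)
      show "underS R d \<subseteq> Field R" by (auto simp: underS_def Field_def)
      show "under R c \<subseteq> underS R d" if "c \<in> underS R d" for c
        using that wo_rel.TRANS[OF lin] wo_rel.ANTISYM[OF lin]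
        by (auto simp: under_def underS_def dest: transD antisymD)
      show "finite (?J \<inter> underS R c)" if "c \<in> underS R d" for c
        using that 1 by (auto simp: underS_def)
    qed
  qed
  have "finite (?J \<inter> Field R)"
  proof (rule segment)
    show "under R d \<subseteq> Field R" for d by (auto simp: under_def Field_def)
  qed (use below in auto)
  moreover have "?J \<inter> Field R = ?J" by auto
  ultimately show ?thesis by simp
qed

section \<open>Recognising points of the induced subspace\<close>

text \<open>By the uniform Cauchy property the approximation \<open>f \<circ> r s \<longrightarrow> f\<close> is uniform, hence some
  sequence of indices already achieves it; take an upper bound of that sequence.\<close>

lemma function_factors_through_some_r:
  assumes f: "cont_fun f"
  shows "\<exists>t\<in>\<Gamma>. \<forall>x\<in>topspace X. f (r t x) = f x"
proof -
  have "\<exists>F. finite F \<and> F \<subseteq> \<Gamma> \<and> (\<forall>x\<in>topspace X. \<bar>f x - f (r (bound F) x)\<bar> \<le> 2 * inverse (Suc n))"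
    for n
  proof -
    let ?\<epsilon> = "inverse (real (Suc n))"
    have \<epsilon>: "0 < ?\<epsilon>" by simp
    obtain F where F: "finite F" "F \<subseteq> \<Gamma>"
      "\<And>G x. finite G \<Longrightarrow> F \<subseteq> G \<Longrightarrow> G \<subseteq> \<Gamma> \<Longrightarrow> x \<in> topspace X \<Longrightarrow>
         \<bar>f (r (bound G) x) - f (r (bound F) x)\<bar> \<le> ?\<epsilon>"
      using uniform_Cauchy[OF subset_refl f \<epsilon>] by blast
    have "\<bar>f x - f (r (bound F) x)\<bar> \<le> 2 * ?\<epsilon>" if x: "x \<in> topspace X" for x
    proof -
      obtain s where s: "s \<in> \<Gamma>" "\<And>t. t \<in> \<Gamma> \<Longrightarrow> (s, t) \<in> le \<Longrightarrow> \<bar>f (r t x) - f x\<bar> < ?\<epsilon>"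
        using eventually_close[OF f x \<epsilon>] by blast
      have "\<bar>f (r (bound (insert s F)) x) - f x\<bar> < ?\<epsilon>"
        using s(1) F by (intro s(2) bound_in le_bound) auto
      moreover have "\<bar>f (r (bound (insert s F)) x) - f (r (bound F) x)\<bar> \<le> ?\<epsilon>"
        using s(1) F(1,2) x by (intro F(3)) auto
      ultimately show ?thesis by linarith
    qed
    then show ?thesis using F by blast
  qed
  then obtain F where F: "\<And>n. finite (F n)" "\<And>n. F n \<subseteq> \<Gamma>"
    "\<And>n x. x \<in> topspace X \<Longrightarrow> \<bar>f x - f (r (bound (F n)) x)\<bar> \<le> 2 * inverse (Suc n)"
    by metis
  obtain t where t: "t \<in> \<Gamma>" "\<And>n. (bound (F n), t) \<in> le"
    using countable_upper_bound[of "range (\<lambda>n. bound (F n))"] F(1,2)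
    by (auto simp: image_subset_iff)
  have "f (r t x) = f x" if x: "x \<in> topspace X" for x
  proof -
    have "\<bar>f (r t x) - f x\<bar> \<le> 4 * inverse (Suc n)" for n
      using F(3)[OF x, of n] F(3)[of "r t x" n] t x r_r_le(1)[of "bound (F n)" t x] F(1,2)
      by auto
    moreover have "\<exists>n. 4 * inverse (real (Suc n)) < \<bar>f (r t x) - f x\<bar>" if "f (r t x) \<noteq> f x"
      using reals_Archimedean[of "\<bar>f (r t x) - f x\<bar> / 4"] that by (auto simp: field_simps)
    ultimately show ?thesis by (meson linorder_not_le)
  qed
  then show ?thesis using t by blast
qed

lemma mem_induced_iff:
  "y \<in> induced_subspace X \<Gamma> r \<longleftrightarrow> y \<in> topspace X \<and> (\<exists>s\<in>\<Gamma>. r s y = y)"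
  unfolding induced_subspace_def by (force simp: image_iff)

lemma r_in_induced: "s \<in> \<Gamma> \<Longrightarrow> x \<in> topspace X \<Longrightarrow> r s x \<in> induced_subspace X \<Gamma> r"
  by (auto simp: induced_subspace_def)

text \<open>Closing off: \<open>\<sigma> (Suc n)\<close> is above an index fixing each function of the supports of \<open>x\<close> and
  of \<open>r (\<sigma> n) x\<close>. At the supremum \<open>t\<close>, a function in one of these supports takes the same value at
  \<open>r t x\<close> and \<open>x\<close>, while every other one vanishes at \<open>x\<close> and along the whole sequence.\<close>

lemma countable_support_imp_induced:
  assumes cont: "\<And>f. f \<in> T \<Longrightarrow> cont_fun f"
    and sep: "\<And>x y. x \<in> topspace X \<Longrightarrow> y \<in> topspace X \<Longrightarrow> \<forall>f\<in>T. f x = f y \<Longrightarrow> x = y"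
    and ctbl: "\<And>y. y \<in> induced_subspace X \<Gamma> r \<Longrightarrow> countable {f \<in> T. f y \<noteq> 0}"
    and x: "x \<in> topspace X" "countable {f \<in> T. f x \<noteq> 0}"
  shows "x \<in> induced_subspace X \<Gamma> r"
proof -
  obtain \<tau> where \<tau>: "\<And>f. f \<in> T \<Longrightarrow> \<tau> f \<in> \<Gamma>" "\<And>f x. f \<in> T \<Longrightarrow> x \<in> topspace X \<Longrightarrow> f (r (\<tau> f) x) = f x"
    using function_factors_through_some_r[OF cont] by metis
  have base: "\<exists>s. s \<in> \<Gamma> \<and> (\<forall>f\<in>T. f x \<noteq> 0 \<longrightarrow> (\<tau> f, s) \<in> le)"
    using countable_upper_bound[OF countable_image[OF x(2)], of \<tau>] \<tau>(1) by auto
  have step: "\<exists>t. (t \<in> \<Gamma> \<and> (\<forall>f\<in>T. f x \<noteq> 0 \<longrightarrow> (\<tau> f, t) \<in> le)) \<and>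
      ((s, t) \<in> le \<and> (\<forall>f\<in>T. f (r s x) \<noteq> 0 \<longrightarrow> (\<tau> f, t) \<in> le))"
    if s: "s \<in> \<Gamma> \<and> (\<forall>f\<in>T. f x \<noteq> 0 \<longrightarrow> (\<tau> f, s) \<in> le)" for s
  proof -
    have cnt: "countable (insert s (\<tau> ` {f \<in> T. f (r s x) \<noteq> 0}))"
      using ctbl r_in_induced s x(1) by simp
    have sub: "insert s (\<tau> ` {f \<in> T. f (r s x) \<noteq> 0}) \<subseteq> \<Gamma>"
      using \<tau>(1) s by blast
    obtain t where
      t: "t \<in> \<Gamma>" "(s, t) \<in> le" "\<And>f. f \<in> T \<Longrightarrow> f (r s x) \<noteq> 0 \<Longrightarrow> (\<tau> f, t) \<in> le"
      using countable_upper_bound[OF cnt sub] by blast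
    then show ?thesis using s trans_le by (meson transD)
  qed
  obtain \<sigma> where \<sigma>: "\<And>n. \<sigma> n \<in> \<Gamma>" "\<And>n f. f \<in> T \<Longrightarrow> f x \<noteq> 0 \<Longrightarrow> (\<tau> f, \<sigma> n) \<in> le"
    "\<And>n. (\<sigma> n, \<sigma> (Suc n)) \<in> le" "\<And>n f. f \<in> T \<Longrightarrow> f (r (\<sigma> n) x) \<noteq> 0 \<Longrightarrow> (\<tau> f, \<sigma> (Suc n)) \<in> le"
    using dependent_nat_choice[of "\<lambda>_ s. s \<in> \<Gamma> \<and> (\<forall>f\<in>T. f x \<noteq> 0 \<longrightarrow> (\<tau> f, s) \<in> le)"
      "\<lambda>_ s t. (s, t) \<in> le \<and> (\<forall>f\<in>T. f (r s x) \<noteq> 0 \<longrightarrow> (\<tau> f, t) \<in> le)", OF base step]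
    by metis
  have inc: "increasing_seq \<Gamma> le \<sigma>" using \<sigma> by (simp add: increasing_seq_def)
  then obtain t where t: "is_seq_sup \<Gamma> le \<sigma> t" using seq_sup_exists by blast
  then have t\<Gamma>: "t \<in> \<Gamma>" and \<sigma>t: "(\<sigma> n, t) \<in> le" for n by (simp_all add: is_seq_sup_def)
  have "f (r t x) = f x" if f: "f \<in> T" for f
  proof (cases "\<exists>n. (\<tau> f, \<sigma> n) \<in> le")
    case True
    then have le: "(\<tau> f, t) \<in> le" using \<sigma>t trans_le by (meson transD)
    have "f (r t x) = f (r (\<tau> f) (r t x))" using \<tau>(2)[OF f r_in[OF t\<Gamma> x(1)]] ..
    also have "\<dots> = f (r (\<tau> f) x)" using r_r_le(1)[OF \<tau>(1)[OF f] t\<Gamma> le x(1)] by simp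
    also have "\<dots> = f x" by (rule \<tau>(2)[OF f x(1)])
    finally show ?thesis .
  next
    case False
    then have zero: "f x = 0" "f (r (\<sigma> n) x) = 0" for n using \<sigma> f by blast+
    have "closedin X {w \<in> topspace X. f w \<in> {0}}"
      by (rule closedin_continuous_map_preimage[OF cont[OF f]]) simp
    then have "r t x \<in> {w \<in> topspace X. f w \<in> {0}}"
      by (rule limitin_closedin[OF limitin_seq_sup[OF inc t x(1)]]) (use zero \<sigma>(1) x(1) in auto)
    then show ?thesis using zero by simp
  qed
  then have "r t x = x" using sep[of "r t x" x] t\<Gamma> x(1) by simp
  then show ?thesis using t\<Gamma> x(1) mem_induced_iff by blast
qed

end

section \<open>Resolving families\<close>

locale commutative_r_skeleton = compact_r_skeleton X \<Gamma> le r
  for X :: "'a topology" and \<Gamma> :: "'s set" and le :: "'s rel" and r :: "'s \<Rightarrow> 'a \<Rightarrow> 'a" +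
  assumes comm: "commutative_family X \<Gamma> r"
begin

text \<open>By commutativity the net \<open>r (bound F) y\<close> stays in the closed set of fixed points
  of \<open>r s\<close>.\<close>

lemma r_rlim_fixed:
  assumes "B \<subseteq> \<Gamma>" "s \<in> \<Gamma>" "y \<in> topspace X" "r s y = y"
  shows "r s (rlim B y) = rlim B y"
proof -
  have "rlim B y \<in> {w \<in> topspace X. r s w = w}"
  proof (rule rlim_in_closed[OF assms(1,3) _ finite.emptyI empty_subsetI])
    show "closedin X {w \<in> topspace X. r s w = w}"
      by (rule closedin_continuous_maps_eq[OF hausdorff continuous_r[OF assms(2)]]) simp
    fix F assume F: "finite F" "F \<subseteq> B"
    then have "bound F \<in> \<Gamma>" using assms by auto
    then have "r s (r (bound F) y) = r (bound F) (r s y)"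
      using comm assms unfolding commutative_family_def by blast
    then show "r (bound F) y \<in> {w \<in> topspace X. r s w = w}"
      using assms \<open>bound F \<in> \<Gamma>\<close> by simp
  qed
  then show ?thesis by simp
qed

lemma rlim_in_induced:
  "B \<subseteq> \<Gamma> \<Longrightarrow> y \<in> induced_subspace X \<Gamma> r \<Longrightarrow> rlim B y \<in> induced_subspace X \<Gamma> r"
  using r_rlim_fixed by (metis mem_induced_iff rlim_in)

text \<open>All points \<open>rlim C y\<close> lie in one cosmic retract, where countably many functions detect every
  jump, and each of these functions has finitely many jumps above each \<open>inverse (Suc n)\<close>.\<close>

lemma countable_jumps:
  assumes R: "Well_order R" and \<Gamma>: "Field R \<subseteq> \<Gamma>" and y: "y \<in> induced_subspace X \<Gamma> r"
  shows "countable {b \<in> Field R. rlim (under R b) y \<noteq> rlim (underS R b) y}"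
proof -
  obtain s where s: "s \<in> \<Gamma>" "r s y = y" and yX: "y \<in> topspace X"
    using y mem_induced_iff by blast
  have range: "r s ` topspace X \<subseteq> topspace X" using s(1) by auto
  obtain G where G: "countable G" "\<forall>g\<in>G. cont_fun g"
      "\<forall>a\<in>r s ` topspace X. \<forall>b\<in>r s ` topspace X. (\<forall>g\<in>G. g a = g b) \<longrightarrow> a = b"
    using cosmic_subspace_countably_separated[OF tych range cosmic_range[OF s(1)]] by blast
  let ?D = "\<lambda>g b. \<bar>g (rlim (under R b) y) - g (rlim (underS R b) y)\<bar>"
  have "b \<in> (\<Union>g\<in>G. \<Union>n. {b \<in> Field R. inverse (real (Suc n)) < ?D g b})"
    if b: "b \<in> Field R" "rlim (under R b) y \<noteq> rlim (underS R b) y" for b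
  proof -
    have sub: "under R b \<subseteq> \<Gamma>" "underS R b \<subseteq> \<Gamma>"
      using \<Gamma> by (auto simp: under_def underS_def Field_def)
    have mem: "rlim C y \<in> r s ` topspace X" if "C \<subseteq> \<Gamma>" for C
      using r_rlim_fixed[OF that s(1) yX s(2)] rlim_in[OF that yX] by (metis image_eqI)
    obtain g where "g \<in> G" "g (rlim (under R b) y) \<noteq> g (rlim (underS R b) y)"
      using G(3)[rule_format, OF mem[OF sub(1)] mem[OF sub(2)]] b(2) by blast
    moreover then obtain n where "inverse (real (Suc n)) < ?D g b"
      using reals_Archimedean[of "?D g b"] by auto
    ultimately show ?thesis using b(1) by blast
  qed
  then have "{b \<in> Field R. rlim (under R b) y \<noteq> rlim (underS R b) y} \<subseteq>
      (\<Union>g\<in>G. \<Union>n. {b \<in> Field R. inverse (real (Suc n)) < ?D g b})" by blast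
  moreover have "countable (\<Union>g\<in>G. \<Union>n. {b \<in> Field R. inverse (real (Suc n)) < ?D g b})"
    using G(1,2) finite_jumps[OF R \<Gamma> _ _ yX]
    by (intro countable_UN) (auto intro!: countable_finite)
  ultimately show ?thesis by (rule countable_subset)
qed

text \<open>Separation is expressed through finite sets of indices because this form passes
  to unions of chains of sets \<open>B\<close>; it is equivalent to separating points that \<open>rlim B\<close>
  separates.\<close>

definition resolving :: "('a \<Rightarrow> real) set \<Rightarrow> 's set \<Rightarrow> bool" where
  "resolving T B \<longleftrightarrow> (\<forall>f\<in>T. cont_fun f) \<and>
     (\<forall>y\<in>induced_subspace X \<Gamma> r. countable {f \<in> T. f y \<noteq> 0}) \<and>
     (\<forall>x\<in>topspace X. \<forall>y\<in>topspace X. (\<forall>f\<in>T. f x = f y) \<longrightarrow>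
        (\<forall>F. finite F \<longrightarrow> F \<subseteq> B \<longrightarrow> r (bound F) x = r (bound F) y))"

lemma resolving_finite:
  assumes "finite B" "B \<subseteq> \<Gamma>"
  shows "\<exists>T. resolving T B"
proof -
  have b: "bound B \<in> \<Gamma>" using assms by simp
  then have range: "r (bound B) ` topspace X \<subseteq> topspace X" by auto
  obtain G where G: "countable G" "\<forall>g\<in>G. cont_fun g"
      "\<forall>a\<in>r (bound B) ` topspace X. \<forall>b\<in>r (bound B) ` topspace X. (\<forall>g\<in>G. g a = g b) \<longrightarrow> a = b"
    using cosmic_subspace_countably_separated[OF tych range cosmic_range[OF b]] by blast
  define T where "T = (\<lambda>g x. g (r (bound B) x)) ` G"
  have "\<forall>f\<in>T. cont_fun f" using G(2) b by (auto simp: T_def intro: continuous_fun_r)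
  moreover have "countable {f \<in> T. f y \<noteq> 0}" for y
    using G(1) by (intro countable_subset[OF Collect_restrict]) (simp add: T_def)
  moreover have "r (bound F) x = r (bound F) y"
    if xy: "x \<in> topspace X" "y \<in> topspace X" "\<forall>f\<in>T. f x = f y" and F: "F \<subseteq> B" for x y F
  proof -
    have "r (bound B) x = r (bound B) y" using G(3) xy unfolding T_def by auto
    then show ?thesis using r_bound_r_bound[OF assms F] xy by metis
  qed
  ultimately have "resolving T B"
    unfolding resolving_def by (intro conjI ballI allI impI; blast)
  then show ?thesis ..
qed

text \<open>The differences \<open>\<Delta> b f\<close> vanish at \<open>y\<close> unless \<open>y\<close> has a jump at \<open>b\<close>, which keeps the union
  point-countable on the induced subspace. If all functions agree at \<open>x\<close> and \<open>y\<close>, then by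
  induction the limit maps strictly below \<open>b\<close> agree there, so the functions \<open>f \<in> S b\<close> agree at the
  images under the limit map up to \<open>b\<close>, and \<open>S b\<close> resolves these. The family \<open>S0\<close> starts the
  induction: at the least element nothing but \<open>r (bound {})\<close> is known.\<close>

lemma resolving_well_order:
  assumes R: "Well_order R" and \<Gamma>: "Field R \<subseteq> \<Gamma>"
    and S: "\<And>b. b \<in> Field R \<Longrightarrow> resolving (S b) (under R b)"
  shows "\<exists>T. resolving T (Field R)"
proof -
  have lin: "wo_rel R" using R by (simp add: wo_rel_def)
  have sub: "under R b \<subseteq> \<Gamma>" "underS R b \<subseteq> \<Gamma>" for b
    using \<Gamma> by (auto simp: under_def underS_def Field_def)
  obtain S0 where S0: "resolving S0 {}" using resolving_finite[of "{}"] by auto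
  define \<Delta> where "\<Delta> b f x = f (rlim (under R b) x) - f (rlim (underS R b) x)" for b and f :: "'a \<Rightarrow> real" and x
  define T where "T = S0 \<union> (\<Union>b\<in>Field R. \<Delta> b ` S b)"
  have "cont_fun f" if "f \<in> T" for f
  proof -
    have "cont_fun (\<Delta> b g)" if "b \<in> Field R" "g \<in> S b" for b g
      unfolding \<Delta>_def using S[OF that(1)] that(2) sub
      by (intro continuous_map_diff continuous_fun_rlim) (auto simp: resolving_def)
    then show ?thesis using that S0 by (auto simp: T_def resolving_def)
  qed
  moreover have "countable {f \<in> T. f y \<noteq> 0}" if y: "y \<in> induced_subspace X \<Gamma> r" for y
  proof -
    define W where "W = {b \<in> Field R. rlim (under R b) y \<noteq> rlim (underS R b) y}"
    define Z where "Z b = {f \<in> S b. f (rlim (under R b) y) \<noteq> 0} \<union> {f \<in> S b. f (rlim (underS R b) y) \<noteq> 0}" for b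
    have "{f \<in> T. f y \<noteq> 0} \<subseteq> {f \<in> S0. f y \<noteq> 0} \<union> (\<Union>b\<in>W. \<Delta> b ` Z b)"
      unfolding T_def W_def Z_def by (auto simp: \<Delta>_def)
    moreover have "countable (Z b)" if "b \<in> W" for b
    proof -
      have "b \<in> Field R" using that by (simp add: W_def)
      then show ?thesis
        unfolding Z_def using S rlim_in_induced[OF sub(1) y] rlim_in_induced[OF sub(2) y]
        by (auto simp: resolving_def)
    qed
    moreover have "countable W" unfolding W_def by (rule countable_jumps[OF R \<Gamma> y])
    moreover have "countable {f \<in> S0. f y \<noteq> 0}" using S0 y by (simp add: resolving_def)
    ultimately show ?thesis
      by (elim countable_subset) (simp add: countable_image)
  qed
  moreover have "r (bound F) x = r (bound F) y"
    if xy: "x \<in> topspace X" "y \<in> topspace X" and eq: "\<forall>f\<in>T. f x = f y"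
      and F: "finite F" "F \<subseteq> Field R" for x y F
  proof -
    have empty: "r (bound {}) x = r (bound {}) y"
    proof -
      have "\<forall>f\<in>S0. f x = f y" using eq by (auto simp: T_def)
      then show ?thesis using S0 xy unfolding resolving_def by blast
    qed
    have agree_from_below: "r (bound F) x = r (bound F) y"
      if F: "finite F" "F \<subseteq> Field R"
        and IH: "\<And>b G. b \<in> F \<Longrightarrow> finite G \<Longrightarrow> G \<subseteq> under R b \<Longrightarrow> r (bound G) x = r (bound G) y" for F
    proof (cases "F = {}")
      case False
      have "\<exists>b\<in>F. F \<subseteq> under R b"
        using F(1) False F(2)
      proof (induction rule: finite_ne_induct)
        case (singleton a)
        then show ?case using wo_rel.REFL[OF lin] by (auto simp: under_def refl_on_def)
      next
        case (insert a F)
        then obtain b where b: "b \<in> F" "F \<subseteq> under R b" by auto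
        have "(a, b) \<in> R \<or> (b, a) \<in> R" "(a, a) \<in> R"
          using wo_rel.TOTALS[OF lin] insert.prems b(1) by auto
        then show ?case
          using b wo_rel.TRANS[OF lin] by (auto simp: under_def dest: transD)
      qed
      then show ?thesis using IH F(1) by blast
    qed (use empty in simp)
    have step: "r (bound G) x = r (bound G) y"
      if "b \<in> Field R" "finite G" "G \<subseteq> under R b" for b G
      using that
    proof (induction b arbitrary: G rule: wo_rel.well_order_induct[OF lin])
      case (1 b)
      have "rlim (underS R b) x = rlim (underS R b) y"
      proof (rule limitin_Hausdorff_unique[OF _ limitin_rlim[OF sub(2) xy(2)] _ hausdorff])
        have "r (bound F) x = r (bound F) y" if F: "finite F" "F \<subseteq> underS R b" for F
        proof (rule agree_from_below[OF F(1)])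
          show "F \<subseteq> Field R" using F by (auto simp: underS_def Field_def)
          fix c G assume "c \<in> F" "finite G" "G \<subseteq> under R c"
          then show "r (bound G) x = r (bound G) y"
            using F by (intro "1.IH"[rule_format, of c]) (auto simp: underS_def Field_def)
        qed
        then have "eventually (\<lambda>F. r (bound F) x = r (bound F) y) (finite_subsets_at_top (underS R b))"
          by (intro eventually_finite_subsets_at_top_weakI)
        then show "limitin X (\<lambda>F. r (bound F) y) (rlim (underS R b) x) (finite_subsets_at_top (underS R b))"
          by (rule limitin_transform_eventually) (rule limitin_rlim[OF sub(2) xy(1)])
      qed simp
      moreover have "\<Delta> b f x = \<Delta> b f y" if "f \<in> S b" for f
        using eq that "1.prems"(1) by (auto simp: T_def)
      ultimately have "\<forall>f\<in>S b. f (rlim (under R b) x) = f (rlim (under R b) y)"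
        by (simp add: \<Delta>_def)
      then have "r (bound G) (rlim (under R b) x) = r (bound G) (rlim (under R b) y)"
        using S[OF "1.prems"(1)] rlim_in[OF sub(1)] xy "1.prems"(2,3)
        unfolding resolving_def by blast
      then show ?case
        using r_bound_rlim[OF sub(1) "1.prems"(2,3)] xy by simp
    qed
    show ?thesis
    proof (rule agree_from_below[OF F])
      fix b G assume "b \<in> F" "finite G" "G \<subseteq> under R b"
      then show "r (bound G) x = r (bound G) y" using F(2) by (intro step[of b]) auto
    qed
  qed
  ultimately have "resolving T (Field R)"
    unfolding resolving_def by (intro conjI ballI allI impI; blast)
  then show ?thesis ..
qed

text \<open>An infinite cardinal has no last element, so even the closed initial segments of \<open>B\<close> have
  smaller cardinality than \<open>B\<close>.\<close>

lemma resolving_exists: "B \<subseteq> \<Gamma> \<Longrightarrow> \<exists>T. resolving T B"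
proof (induction "card_of B" arbitrary: B rule: wf_induct_rule[OF wf_ordLess])
  case 1
  show ?case
  proof (cases "finite B")
    case True
    then show ?thesis using resolving_finite 1 by blast
  next
    case False
    let ?R = "card_of B"
    have field: "Field ?R = B" by (rule Field_card_of)
    have "\<exists>T. resolving T (under ?R b)" if b: "b \<in> B" for b
    proof -
      obtain c where c: "c \<in> B" "b \<noteq> c" "(b, c) \<in> ?R"
        using infinite_Card_order_limit[OF card_of_Card_order, of B b] False b field by auto
      have lin: "wo_rel ?R" using card_of_Well_order by (simp add: wo_rel_def)
      have "under ?R b \<subseteq> underS ?R c"
        using c wo_rel.TRANS[OF lin] wo_rel.ANTISYM[OF lin]
        by (auto simp: under_def underS_def dest: transD antisymD)
      then have "(card_of (under ?R b), ?R) \<in> ordLess"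
        using card_of_mono1 card_of_underS[OF card_of_Card_order, of c B] c(1) field
          ordLeq_ordLess_trans by metis
      moreover have "under ?R b \<subseteq> \<Gamma>"
        using 1(2) field by (auto simp: under_def Field_def)
      ultimately show ?thesis by (rule 1(1))
    qed
    then obtain S where "\<And>b. b \<in> B \<Longrightarrow> resolving (S b) (under ?R b)" by metis
    then show ?thesis
      using resolving_well_order[of ?R S] card_of_Well_order 1(2) field by metis
  qed
qed

lemma induced_is_Sigma_subset: "Sigma_subset X (induced_subspace X \<Gamma> r)"
proof -
  obtain T where T: "resolving T \<Gamma>" using resolving_exists by blast
  have cont: "cont_fun f" if "f \<in> T" for f using T that by (simp add: resolving_def)
  have ctbl: "countable {f \<in> T. f y \<noteq> 0}" if "y \<in> induced_subspace X \<Gamma> r" for y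
    using T that by (simp add: resolving_def)
  have sep: "x = y" if xy: "x \<in> topspace X" "y \<in> topspace X" "\<forall>f\<in>T. f x = f y" for x y
  proof (rule r_separates[OF xy(1,2)])
    fix s assume s: "s \<in> \<Gamma>"
    have "r (bound {s}) x = r (bound {s}) y"
      using T xy s unfolding resolving_def by blast
    moreover have "r s (r (bound {s}) z) = r s z" if "z \<in> topspace X" for z
      using s that by (intro r_r_le(1) le_bound bound_in) auto
    ultimately show "r s x = r s y" using xy by metis
  qed
  have eq: "induced_subspace X \<Gamma> r = {x \<in> topspace X. countable {f \<in> T. f x \<noteq> 0}}"
  proof (intro equalityI subsetI CollectI conjI)
    fix x assume x: "x \<in> induced_subspace X \<Gamma> r"
    show "x \<in> topspace X" using x by (simp add: mem_induced_iff)
    show "countable {f \<in> T. f x \<noteq> 0}" using x by (rule ctbl)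
  next
    fix x assume "x \<in> {x \<in> topspace X. countable {f \<in> T. f x \<noteq> 0}}"
    then show "x \<in> induced_subspace X \<Gamma> r"
      using countable_support_imp_induced[OF cont sep ctbl] by blast
  qed
  show ?thesis
    unfolding eq by (rule Sigma_subset_of_separating_family[OF comp cont sep])
qed

end

theorem theorem2p6:
  fixes X :: "'a topology" and Y :: "'a set"
    and \<Gamma> :: "'s set" and le :: "'s rel" and r :: "'s \<Rightarrow> 'a \<Rightarrow> 'a"
  assumes "tychonoff_space X"
    and "compact_space X"
    and "Y \<subseteq> topspace X"
    and "X closure_of Y = topspace X"
    and "r_skeleton X \<Gamma> le r"
    and "commutative_family X \<Gamma> r"
    and "Y = induced_subspace X \<Gamma> r"
  shows "Sigma_subset X Y"
  \<comment> \<open>Without indices \<open>Y\<close> is empty, and density makes \<open>X\<close> empty as well.\<close>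
proof (cases "\<Gamma> = {}")
  case True
  then have "Y = {}" using assms(7) by (simp add: induced_subspace_def)
  then have "topspace X = {}" using assms(4) by simp
  then show ?thesis
    using Sigma_subset_of_separating_family[OF assms(2), of "{}"] \<open>Y = {}\<close> by simp
next
  case False
  interpret commutative_r_skeleton X \<Gamma> le r
    by unfold_locales (use assms False in auto)
  show ?thesis using induced_is_Sigma_subset assms(7) by simp
qed

end
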